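(* For $a > 0$ let $C_{[-a,a]}$ denote the best (smallest) constant $C$ such that $\|q\|_{[-a,a]} \le C^n \|p\|_{[-a,a]}$ for every $n \ge 1$, every monic polynomial $p$ of degree $n$ with complex coefficients, and every monic factor $q$ of $p$. Then $$C_{[-a,a]} = \begin{cases} \dfrac{2}{a}, & 0 < a \le 1/2, \\[2ex] \dfrac{2}{a} \exp\left( \displaystyle\int_{1-a}^{a} \frac{\log(t+a)}{\pi\sqrt{a^2 - t^2}}\, dt \right), & a > 1/2. \end{cases}$$
   Context: For a compact set $E \subset \mathbb{C}$, $\|f\|_E := \sup_{z\in E} |f(z)|$; here $E = [-a,a]$ is the real segment viewed as a subset of $\mathbb{C}$. A monic factor of a monic polynomial $p \in \mathbb{C}[z]$ is a monic polynomial $q$ such that $p = q r$ for some monic polynomial $r$. *)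

theory Defs
  imports "HOL-Analysis.Analysis" "HOL-Computational_Algebra.Polynomial"
begin

text \<open>The supremum is taken in the reals, so it is the intended norm only if \<open>E\<close> is nonempty
  and \<open>f\<close> is bounded on \<open>E\<close>, e.g. for \<open>f\<close> continuous and \<open>E\<close> compact and nonempty.\<close>
definition sup_norm_on :: "complex set \<Rightarrow> (complex \<Rightarrow> complex) \<Rightarrow> real" where
  "sup_norm_on E f = (SUP z\<in>E. cmod (f z))"

definition monic_poly :: "complex poly \<Rightarrow> bool" where
  "monic_poly p \<longleftrightarrow> lead_coeff p = 1"

definition monic_factor :: "complex poly \<Rightarrow> complex poly \<Rightarrow> bool" where
  "monic_factor q p \<longleftrightarrow> monic_poly q \<and> (\<exists>r. monic_poly r \<and> p = q * r)"

text \<open>The exponent is the degree \<open>n\<close> of \<open>p\<close>, not that of the factor \<open>q\<close>; both \<open>q = 1\<close> and \<open>q = p\<close>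
  are allowed.\<close>
definition factor_constant :: "complex set \<Rightarrow> real \<Rightarrow> bool" where
  "factor_constant E C \<longleftrightarrow>
     (\<forall>n p q. n \<ge> 1 \<longrightarrow> monic_poly p \<longrightarrow> degree p = n \<longrightarrow> monic_factor q p \<longrightarrow>
        sup_norm_on E (poly q) \<le> C ^ n * sup_norm_on E (poly p))"

definition best_factor_constant :: "complex set \<Rightarrow> real \<Rightarrow> bool" where
  "best_factor_constant E C \<longleftrightarrow>
     factor_constant E C \<and> (\<forall>C'. factor_constant E C' \<longrightarrow> C \<le> C')"

definition real_segment :: "real \<Rightarrow> complex set" where
  "real_segment a = complex_of_real ` {-a..a}"

end

theory Submission
  imports Defs "HOL-Complex_Analysis.Conformal_Mappings"
    "HOL-Computational_Algebra.Fundamental_Theorem_Algebra"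
begin

text \<open>If \<open>q\<close> is a factor of \<open>p\<close>, then \<open>\<bar>q u\<bar>\<close> is at most the product of \<open>max 1 \<bar>z - u\<bar>\<close> over the
  zeros \<open>z\<close> of \<open>p\<close>, which by Jensen's formula is the geometric mean of \<open>\<bar>p\<bar>\<close> over the unit circle
  around \<open>u\<close>. The Bernstein--Walsh inequality bounds \<open>\<bar>p\<bar>\<close> there by the norm of \<open>p\<close> and the Green
  function of the segment; the circle mean of the latter is \<open>ln (2 / a)\<close> plus the mean of
  \<open>ln (max 1 \<bar>t - u\<bar>)\<close> over the equilibrium measure, and is largest for \<open>u = a\<close>. All means over
  circles and over the equilibrium measure are replaced by finite products over roots of unity,
  which can be evaluated exactly. Equality is attained asymptotically by polynomials with zeros
  \<open>a * cos (2 * pi * k / M)\<close>.\<close>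

subsection \<open>Roots of unity and Riemann sums\<close>

text \<open>For \<open>c = 1\<close> both sides are monic of degree \<open>N\<close> in
  \<open>x\<close> and vanish at the \<open>N\<close>-th roots of unity, so their difference has
  degree below \<open>N\<close> but at least \<open>N\<close> roots. The case
  \<open>c \<noteq> 0\<close> follows by scaling \<open>x\<close> to \<open>x / c\<close>.\<close>

lemma prod_diff_roots_of_unity:
  fixes x c :: complex
  assumes "N \<ge> 1"
  shows "(\<Prod>k<N. x - c * cis (2 * pi * real k / real N)) = x ^ N - c ^ N"
proof (cases "c = 0")
  case True
  then show ?thesis using assms by (simp add: power_0_left)
next
  case False
  let ?w = "\<lambda>k. cis (2 * pi * real k / real N)"
  have N: "0 < N" using assms by simp
  have bij: "bij_betw ?w {..<N} {z. z ^ N = 1}"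
    by (rule Complex.bij_betw_roots_unity[OF N])
  define P :: "complex poly" where "P = monom 1 N - 1"
  define Q :: "complex poly" where "Q = (\<Prod>k<N. [:- ?w k, 1:])"
  have degQ: "degree Q = N" unfolding Q_def by (subst degree_prod_sum_eq) auto
  have lcQ: "lead_coeff Q = 1" unfolding Q_def by (subst lead_coeff_prod) simp
  have degP: "degree P = N" unfolding P_def
    using N degree_add_eq_left[of "-1" "monom 1 N :: complex poly"] by (simp add: degree_monom_eq)
  have lcP: "coeff P N = 1" unfolding P_def using N by simp
  have "P = Q"
  proof (rule ccontr)
    assume ne: "P \<noteq> Q"
    have deg: "degree (P - Q) < N"
    proof (rule degree_lessI)
      show "P - Q \<noteq> 0 \<or> 0 < N" using N by simp
      show "\<forall>k\<ge>N. coeff (P - Q) k = 0"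
        using degP degQ lcP lcQ by (metis coeff_diff coeff_eq_0 diff_self le_neq_implies_less)
    qed
    have "{z. z ^ N = 1} \<subseteq> {z. poly (P - Q) z = 0}"
    proof
      fix z :: complex assume z: "z \<in> {z. z ^ N = 1}"
      then obtain k where "k < N" "z = ?w k" using bij unfolding bij_betw_def by (metis (no_types, lifting) imageE lessThan_iff)
      then show "z \<in> {z. poly (P - Q) z = 0}" using z
        by (auto simp: P_def Q_def poly_monom poly_prod)
    qed
    moreover have "finite {z. poly (P - Q) z = 0}" using ne by (intro poly_roots_finite) simp
    ultimately have "card {z::complex. z ^ N = 1} \<le> card {z. poly (P - Q) z = 0}"
      by (rule card_mono[rotated])
    also have "\<dots> \<le> degree (P - Q)" using ne by (intro card_poly_roots_bound) simp
    finally show False using deg assms by (simp add: card_complex_roots_unity)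
  qed
  have "(\<Prod>k<N. x - c * ?w k) = (\<Prod>k<N. c * (x / c - ?w k))"
    using False by (intro prod.cong) (auto simp: algebra_simps)
  also have "\<dots> = c ^ N * poly Q (x / c)"
    by (simp add: prod.distrib Q_def poly_prod)
  also have "\<dots> = x ^ N - c ^ N"
    using False by (simp add: \<open>P = Q\<close>[symmetric] P_def poly_monom field_simps)
  finally show ?thesis .
qed

text \<open>On each subinterval the mean value theorem turns the increment of the antiderivative
  \<open>F\<close> into \<open>f z * h\<close>, and uniform continuity compares \<open>f z\<close>
  with the value at the left end. The errors add up to at most
  \<open>e' * (b - a) = e / 2\<close>.\<close>

lemma riemann_sum_tendsto_integral:
  fixes f :: "real \<Rightarrow> real"
  assumes cont: "continuous_on {a..b} f" and "a < b"
  shows "(\<lambda>M. (\<Sum>k<M. f (a + (b - a) * real k / real M)) * ((b - a) / real M))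
           \<longlonglongrightarrow> integral {a..b} f"
proof (rule LIMSEQ_I)
  fix e :: real assume e: "e > 0"
  define e' where "e' = e / (2 * (b - a))"
  have e': "e' > 0" unfolding e'_def using e assms by simp
  obtain d where d: "d > 0" "\<And>x y. x \<in> {a..b} \<Longrightarrow> y \<in> {a..b} \<Longrightarrow> dist y x < d \<Longrightarrow> dist (f y) (f x) < e'"
    using compact_uniformly_continuous[OF cont] e' unfolding uniformly_continuous_on_def by (metis compact_Icc)
  define F where "F = (\<lambda>t. integral {a..t} f)"
  have F: "(F has_real_derivative f t) (at t within {a..b})" if "t \<in> {a..b}" for t
    unfolding F_def using integral_has_real_derivative[OF cont that] .
  obtain M0 :: nat where M0: "M0 > (b - a) / d" using reals_Archimedean2 by blast
  show "\<exists>no. \<forall>M\<ge>no. norm ((\<Sum>k<M. f (a + (b - a) * real k / real M)) * ((b - a) / real M) - integral {a..b} f) < e"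
  proof (intro exI allI impI)
    fix M assume "M \<ge> Suc M0"
    then have M: "real M > (b - a) / d" "M > 0" using M0 by linarith+
    define h where "h = (b - a) / real M"
    define x where "x = (\<lambda>k. a + h * real k)"
    have h: "h > 0" "h < d" using M assms d by (auto simp: h_def field_simps)
    have hM: "h * real M = b - a" using M by (simp add: h_def)
    have step: "\<bar>f (x k) * h - (F (x (Suc k)) - F (x k))\<bar> \<le> e' * h" if k: "k < M" for k
    proof -
      have lt: "x k < x (Suc k)" using h by (simp add: x_def algebra_simps)
      have "h * real (Suc k) \<le> h * real M" using k h by (intro mult_left_mono) auto
      then have sub: "{x k..x (Suc k)} \<subseteq> {a..b}" using h hM by (auto simp: x_def intro: order_trans[of _ "a + h * real k"])
      have "\<exists>z\<in>{x k<..<x (Suc k)}. F (x (Suc k)) - F (x k) = (\<lambda>t. f z * t) (x (Suc k) - x k)"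
      proof (rule mvt_simple[OF lt])
        fix t assume "x k \<le> t" "t \<le> x (Suc k)"
        then have "(F has_real_derivative f t) (at t within {x k..x (Suc k)})"
          using sub by (intro DERIV_subset[OF F sub]) auto
        then show "(F has_derivative (\<lambda>s. f t * s)) (at t within {x k..x (Suc k)})"
          by (simp add: has_field_derivative_def)
      qed
      then obtain z where z: "x k < z" "z < x (Suc k)" "F (x (Suc k)) - F (x k) = f z * h"
        by (auto simp: x_def algebra_simps)
      have "x (Suc k) - x k = h" by (simp add: x_def algebra_simps)
      then have "dist (f (x k)) (f z) < e'"
        using z sub h lt by (intro d(2)) (auto simp: dist_real_def)
      then have "\<bar>f (x k) - f z\<bar> * h \<le> e' * h"
        using h by (intro mult_right_mono) (auto simp: dist_real_def)
      then show ?thesis using z(3) h by (simp add: abs_mult left_diff_distrib[symmetric])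
    qed
    have "integral {a..b} f = F (x M) - F (x 0)"
      using hM by (simp add: F_def x_def algebra_simps)
    also have "\<dots> = (\<Sum>k<M. F (x (Suc k)) - F (x k))"
      by (rule sum_lessThan_telescope[symmetric])
    finally have I: "integral {a..b} f = (\<Sum>k<M. F (x (Suc k)) - F (x k))" .
    have "\<bar>(\<Sum>k<M. f (x k)) * h - integral {a..b} f\<bar> = \<bar>\<Sum>k<M. f (x k) * h - (F (x (Suc k)) - F (x k))\<bar>"
      by (simp add: I sum_subtractf sum_distrib_right)
    also have "\<dots> \<le> (\<Sum>k<M. e' * h)"
      using step by (intro order_trans[OF sum_abs] sum_mono) auto
    also have "\<dots> = e' * (h * real M)" by simp
    also have "\<dots> = e' * (b - a)" by (simp only: hM)
    also have "\<dots> < e" using assms e by (simp add: e'_def field_simps)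
    finally show "norm ((\<Sum>k<M. f (a + (b - a) * real k / real M)) * ((b - a) / real M) - integral {a..b} f) < e"
      by (simp add: x_def h_def mult.commute)
  qed
qed

text \<open>As a function of \<open>x\<close>, the integral over \<open>{x..x + T}\<close> has
  derivative \<open>f (x + T) - f x = 0\<close>.\<close>

lemma integral_periodic_shift:
  fixes f :: "real \<Rightarrow> real"
  assumes cont: "continuous_on UNIV f" and per: "\<And>x. f (x + T) = f x" and "T \<ge> 0"
  shows "integral {c..c + T} f = integral {0..T} f"
proof -
  \<comment> \<open>The interval from \<open>-R\<close> to \<open>R\<close> contains
    \<open>x\<close> and \<open>x + T\<close> in its interior whenever
    \<open>\<bar>x\<bar> \<le> \<bar>c\<bar>\<close>, so one antiderivative \<open>F\<close> is
    differentiable at both.\<close>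
  define R where "R = \<bar>c\<bar> + T + 1"
  define F where "F = (\<lambda>t. integral {-R..t} f)"
  have F: "(F has_real_derivative f t) (at t)" if "t \<in> {-R<..<R}" for t
  proof -
    have "(F has_real_derivative f t) (at t within {-R..R})"
      unfolding F_def using that cont
      by (intro integral_has_real_derivative continuous_on_subset[OF cont]) auto
    then show ?thesis using that by (simp add: at_within_Icc_at)
  qed
  have I: "integral {x..x + T} f = F (x + T) - F x" if "x \<in> {-\<bar>c\<bar>..\<bar>c\<bar>}" for x
  proof -
    have "f integrable_on {-R..x + T}"
      by (intro integrable_continuous_real continuous_on_subset[OF cont]) auto
    from Henstock_Kurzweil_Integration.integral_combine[OF _ _ this, of x] that \<open>T \<ge> 0\<close>
    show ?thesis by (simp add: F_def R_def)
  qed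
  have "F (c + T) - F c = F (0 + T) - F 0"
  proof (rule has_derivative_zero_unique[where f = "\<lambda>x. F (x + T) - F x" and s = "{-\<bar>c\<bar>..\<bar>c\<bar>}"])
    show "convex {-\<bar>c\<bar>..\<bar>c\<bar>}" by simp
    fix x assume x: "x \<in> {-\<bar>c\<bar>..\<bar>c\<bar>}"
    have "((\<lambda>x. F (x + T) - F x) has_real_derivative f (x + T) * 1 - f x) (at x within {-\<bar>c\<bar>..\<bar>c\<bar>})"
      using x \<open>T \<ge> 0\<close>
      by (intro DERIV_diff DERIV_chain2[of F] has_field_derivative_at_within[OF F])
        (auto simp: R_def intro!: derivative_eq_intros)
    then show "((\<lambda>x. F (x + T) - F x) has_derivative (\<lambda>h. 0)) (at x within {-\<bar>c\<bar>..\<bar>c\<bar>})"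
      by (simp add: per has_field_derivative_def lambda_zero)
  qed auto
  moreover have "c \<in> {-\<bar>c\<bar>..\<bar>c\<bar>}" "0 \<in> {-\<bar>c\<bar>..\<bar>c\<bar>}" by auto
  ultimately show ?thesis using I[of c] I[of 0] by simp
qed

subsection \<open>Logarithmic potentials on the segment\<close>

text \<open>Under \<open>x = a * cos t\<close> the uniform measure on the circle becomes the equilibrium measure
  of the segment, so \<open>mean_potential a\<close> is the mean of \<open>max 0 (ln \<bar>x - a\<bar>)\<close> against it.\<close>

definition endpoint_potential :: "real \<Rightarrow> real \<Rightarrow> real" where
  "endpoint_potential a t = ln (max 1 (a - a * cos t))"

definition mean_potential :: "real \<Rightarrow> real" where
  "mean_potential a = integral {0..2 * pi} (endpoint_potential a) / (2 * pi)"

lemma endpoint_potential_minus [simp]: "endpoint_potential a (- t) = endpoint_potential a t"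
  by (simp add: endpoint_potential_def)

lemma endpoint_potential_periodic [simp]: "endpoint_potential a (t + 2 * pi) = endpoint_potential a t"
  by (simp add: endpoint_potential_def)

lemma continuous_on_endpoint_potential [continuous_intros]:
  fixes g :: "real \<Rightarrow> real"
  shows "continuous_on S g \<Longrightarrow> continuous_on S (\<lambda>t. endpoint_potential a (g t))"
  unfolding endpoint_potential_def
  by (intro continuous_intros) (auto simp: max_def)

text \<open>The averages are Riemann sums over a full period, so the shift \<open>c\<close> does not
  affect the limit.\<close>

lemma mean_endpoint_potential_tendsto:
  "(\<lambda>M. (\<Sum>k<M. endpoint_potential a (2 * pi * real k / real M - c)) / real M) \<longlonglongrightarrow> mean_potential a"
proof -
  let ?f = "\<lambda>t. endpoint_potential a (t - c)"
  have "integral {0..2 * pi} ?f = integral {0..2 * pi} (endpoint_potential a \<circ> (\<lambda>t. t + (- c)))"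
    by (simp add: o_def)
  also have "\<dots> = integral {- c..- c + 2 * pi} (endpoint_potential a)"
    by (subst integral_shift) (auto intro!: continuous_intros simp: add.commute)
  also have "\<dots> = integral {0..2 * pi} (endpoint_potential a)"
    by (rule integral_periodic_shift) (auto intro!: continuous_intros)
  finally have I: "integral {0..2 * pi} ?f = 2 * pi * mean_potential a"
    by (simp add: mean_potential_def)
  have "(\<lambda>M. (\<Sum>k<M. ?f (0 + (2 * pi - 0) * real k / real M)) * ((2 * pi - 0) / real M))
      \<longlonglongrightarrow> integral {0..2 * pi} ?f"
    by (rule riemann_sum_tendsto_integral) (auto intro!: continuous_intros)
  from tendsto_divide[OF this tendsto_const[of "2 * pi"]] show ?thesis
    by (simp add: I)
qed

text \<open>Averaged over \<open>s\<close>, this says that the endpoints maximise the mean of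
  \<open>ln (max 1 \<bar>x - u\<bar>)\<close> over \<open>u\<close> in the segment. It rests on
  \<open>(max 1 (v * w))\<^sup>2 \<le> max 1 (v\<^sup>2) * max 1 (w\<^sup>2)\<close> for the two sines whose product is the distance.\<close>

lemma ln_dist_le_endpoint_potential:
  assumes "a > 0"
  shows "ln (max 1 \<bar>a * cos s - a * cos t\<bar>) \<le> (endpoint_potential a (s - t) + endpoint_potential a (s + t)) / 2"
proof -
  define x y where "x = a - a * cos (s - t)" and "y = a - a * cos (s + t)"
  have nonneg: "x \<ge> 0" "y \<ge> 0" using assms by (auto simp: x_def y_def)
  have *: "a - a * cos r = 2 * a * (sin (r / 2))\<^sup>2" for r
    using cos_double_sin[of "r / 2"] by (simp add: right_diff_distrib)
  have x: "x = 2 * a * (sin ((s - t) / 2))\<^sup>2" and y: "y = 2 * a * (sin ((s + t) / 2))\<^sup>2"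
    unfolding x_def y_def by (fact *)+
  have "a * cos s - a * cos t = 2 * a * (sin ((s + t) / 2) * sin ((t - s) / 2))"
    using cos_diff_cos[of s t] by (simp add: right_diff_distrib[symmetric])
  also have "sin ((t - s) / 2) = - sin ((s - t) / 2)"
    by (metis minus_diff_eq minus_divide_left sin_minus)
  finally have sq: "\<bar>a * cos s - a * cos t\<bar>\<^sup>2 = x * y"
    by (simp add: x y power_mult_distrib power2_eq_square)
  have "(max 1 \<bar>a * cos s - a * cos t\<bar>)\<^sup>2 \<le> max 1 x * max 1 y"
  proof (cases "\<bar>a * cos s - a * cos t\<bar> \<le> 1")
    case True
    then show ?thesis by (simp add: max_absorb1 mult_ge1_I)
  next
    case False
    then show ?thesis using sq nonneg by (auto simp: intro!: mult_mono)
  qed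
  then have "ln ((max 1 \<bar>a * cos s - a * cos t\<bar>)\<^sup>2) \<le> ln (max 1 x * max 1 y)"
    by (subst ln_le_cancel_iff) (auto simp: max_def intro: mult_pos_pos zero_less_power)
  then have "2 * ln (max 1 \<bar>a * cos s - a * cos t\<bar>) \<le> ln (max 1 x) + ln (max 1 y)"
    by (subst (asm) ln_realpow) (auto simp: ln_mult_pos max_def)
  then show ?thesis by (simp add: endpoint_potential_def x_def y_def)
qed

text \<open>With \<open>u = a * cos t\<close>, summing the previous inequality over the nodes bounds
  the left side by the average of two Riemann sums, with shifts \<open>t\<close> and
  \<open>-t\<close>, which have the same limit.\<close>

lemma eventually_sum_ln_dist_le:
  assumes "a > 0" "u \<in> {-a..a}" "e > 0"
  shows "\<forall>\<^sub>F M in sequentially.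
    (\<Sum>k<M. ln (max 1 \<bar>a * cos (2 * pi * real k / real M) - u\<bar>)) \<le> real M * (mean_potential a + e)"
proof -
  define t where "t = arccos (u / a)"
  have u: "u = a * cos t" using assms by (simp add: t_def cos_arccos field_simps)
  let ?S = "\<lambda>c M. (\<Sum>k<M. endpoint_potential a (2 * pi * real k / real M - c)) / real M"
  have "\<forall>\<^sub>F M in sequentially. ?S t M < mean_potential a + e"
    "\<forall>\<^sub>F M in sequentially. ?S (-t) M < mean_potential a + e"
    using assms by (intro order_tendstoD(2)[OF mean_endpoint_potential_tendsto]; simp)+
  then show ?thesis using eventually_gt_at_top[of 0]
  proof eventually_elim
    case (elim M)
    have "(\<Sum>k<M. ln (max 1 \<bar>a * cos (2 * pi * real k / real M) - u\<bar>))
        \<le> (\<Sum>k<M. (endpoint_potential a (2 * pi * real k / real M - t)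
              + endpoint_potential a (2 * pi * real k / real M + t)) / 2)"
      unfolding u using assms by (intro sum_mono ln_dist_le_endpoint_potential)
    also have "\<dots> = real M * ((?S t M + ?S (-t) M) / 2)"
      using elim by (simp add: sum.distrib sum_divide_distrib[symmetric] field_simps)
    also have "\<dots> \<le> real M * (mean_potential a + e)"
      using elim by (intro mult_left_mono) auto
    finally show ?case .
  qed
qed

subsection \<open>The Joukowski map\<close>

text \<open>Conjugate roots of unity are paired: \<open>(z - cis t) * (z - cis (- t))\<close> equals
  \<open>z\<^sup>2 - 2 * cos t * z + 1\<close>, which is \<open>z\<close> times the factor for the
  node \<open>a * cos t\<close>. The square appears because the product over the conjugate roots is
  again \<open>z ^ M - 1\<close>.\<close>

lemma joukowski_prod:
  fixes z :: complex
  assumes "z \<noteq> 0" "a > 0" "M \<ge> 1"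
  shows "z ^ M * (\<Prod>k<M. 2 / of_real a * (of_real a * (z + 1 / z) / 2 - of_real (a * cos (2 * pi * real k / real M))))
    = (z ^ M - 1)\<^sup>2"
proof -
  let ?c = "\<lambda>k. cis (2 * pi * real k / real M)"
  have *: "(\<Prod>k<M. x - ?c k) = x ^ M - 1" for x
    using prod_diff_roots_of_unity[of M x 1] assms by simp
  have "(\<Prod>k<M. z - cnj (?c k)) = cnj (\<Prod>k<M. cnj z - ?c k)"
    by (simp add: cnj_prod)
  also have "\<dots> = z ^ M - 1" by (simp add: *)
  finally have "(z ^ M - 1)\<^sup>2 = (\<Prod>k<M. (z - ?c k) * (z - cnj (?c k)))"
    by (simp add: prod.distrib * power2_eq_square)
  also have "\<dots> = (\<Prod>k<M. z * (2 / of_real a * (of_real a * (z + 1 / z) / 2 - of_real (a * cos (2 * pi * real k / real M)))))"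
  proof (rule prod.cong)
    fix k
    define t where "t = 2 * pi * real k / real M"
    have 1: "cis t * cnj (cis t) = 1" by (simp add: cis_mult cis_cnj)
    have 2: "cis t + cnj (cis t) = 2 * of_real (cos t)" by (simp add: complex_eq_iff)
    have "(z - cis t) * (z - cnj (cis t)) = z\<^sup>2 - (cis t + cnj (cis t)) * z + cis t * cnj (cis t)"
      by (simp add: algebra_simps power2_eq_square)
    also have "\<dots> = z * (2 / of_real a * (of_real a * (z + 1 / z) / 2 - of_real (a * cos t)))"
      unfolding 1 2 using assms by (simp add: field_simps power2_eq_square)
    finally show "(z - ?c k) * (z - cnj (?c k)) =
      z * (2 / of_real a * (of_real a * (z + 1 / z) / 2 - of_real (a * cos (2 * pi * real k / real M))))"
      unfolding t_def .
  qed simp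
  finally show ?thesis by (simp only: prod.distrib prod_constant card_lessThan)
qed

text \<open>The two solutions of the quadratic equation for \<open>z\<close> are inverse to each
  other, so one lies outside the unit circle unless both lie on it; in that case they are conjugate
  and \<open>w\<close> is real.\<close>

lemma ex_joukowski:
  assumes "a > 0" "w \<notin> \<real>"
  obtains z :: complex where "cmod z > 1" "w = of_real a * (z + 1 / z) / 2"
proof -
  define v where "v = w / of_real a"
  define s where "s = csqrt (v\<^sup>2 - 1)"
  have s2: "s\<^sup>2 = v\<^sup>2 - 1" by (simp add: s_def)
  have prod: "(v + s) * (v - s) = 1" using s2 by (simp add: algebra_simps power2_eq_square)
  then have nz: "v + s \<noteq> 0" "v - s \<noteq> 0" by auto
  have inv: "1 / (v + s) = v - s" "1 / (v - s) = v + s" using prod nz by (auto simp: field_simps)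
  have w: "w = of_real a * ((v + s) + (v - s)) / 2" using assms by (simp add: v_def)
  have ne: "cmod (v + s) \<noteq> 1"
  proof
    assume "cmod (v + s) = 1"
    then have "v - s = cnj (v + s)" using inv(1) by (metis complex_div_cnj divide_cancel_right mult_1 power_one div_by_1 of_real_1)
    then have "w = of_real (a * Re (v + s))" using w by (simp add: complex_eq_iff)
    then show False using assms by auto
  qed
  have "cmod (v + s) * cmod (v - s) = 1" using prod by (metis norm_mult norm_one)
  then have "cmod (v + s) > 1 \<or> cmod (v - s) > 1"
    using ne by (metis linorder_neqE_linordered_idom mult.commute mult_less_cancel_left1 norm_ge_zero norm_le_zero_iff nz(1) not_less mult_less_cancel_right1)
  then show ?thesis
  proof
    assume "cmod (v + s) > 1"
    then show ?thesis using that[of "v + s"] w inv by simp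
  next
    assume "cmod (v - s) > 1"
    then show ?thesis using that[of "v - s"] w inv by (simp add: add.commute)
  qed
qed

text \<open>The function \<open>x ^ degree p * poly p (a * (x + 1 / x) / 2)\<close> is a polynomial in \<open>x\<close>, bounded by
  \<open>B\<close> on the unit circle; the maximum principle is applied to it at \<open>1 / z\<close>.\<close>

lemma bernstein_walsh_segment:
  fixes p :: "complex poly" and z :: complex
  assumes a: "a > 0" and bound: "\<And>t. t \<in> {-a..a} \<Longrightarrow> cmod (poly p (of_real t)) \<le> B" and z: "cmod z \<ge> 1"
  shows "cmod (poly p (of_real a * (z + 1 / z) / 2)) \<le> B * cmod z ^ degree p"
proof -
  define n where "n = degree p"
  define J where "J = (\<lambda>x::complex. of_real a * (x + 1 / x) / 2)"
  define f where "f = (\<lambda>x::complex. \<Sum>i\<le>n. coeff p i * (of_real a / 2 * (x\<^sup>2 + 1)) ^ i * x ^ (n - i))"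
  have f: "f x = x ^ n * poly p (J x)" if "x \<noteq> 0" for x
  proof -
    have "coeff p i * (of_real a / 2 * (x\<^sup>2 + 1)) ^ i * x ^ (n - i) = x ^ n * (coeff p i * J x ^ i)" if "i \<le> n" for i
    proof -
      have "x ^ n = x ^ i * x ^ (n - i)" using that by (simp add: power_add[symmetric])
      moreover have "(of_real a / 2 * (x\<^sup>2 + 1)) ^ i = (x * J x) ^ i"
        using \<open>x \<noteq> 0\<close> by (simp add: J_def algebra_simps power2_eq_square)
      moreover have "(x * J x) ^ i = x ^ i * J x ^ i" by (rule power_mult_distrib)
      ultimately show ?thesis by simp
    qed
    then show ?thesis unfolding f_def poly_altdef n_def[symmetric] sum_distrib_left
      by (intro sum.cong refl) (metis atMost_iff)
  qed
  have circle: "cmod (f x) \<le> B" if "cmod x = 1" for x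
  proof -
    have x: "x \<noteq> 0" using that by auto
    \<comment> \<open>On the unit circle the Joukowski map takes the values \<open>a * Re x\<close>,
      which lie in the segment.\<close>
    have "1 / x = cnj x" using that by (metis complex_div_cnj mult_1 power_one div_by_1 of_real_1)
    then have "J x = of_real (a * Re x)" by (simp add: J_def complex_eq_iff)
    moreover have "a * Re x \<in> {-a..a}"
      using abs_Re_le_cmod[of x] that a mult_left_mono[of "-1" "Re x" a] mult_left_mono[of "Re x" 1 a]
      by auto
    ultimately show ?thesis using bound[of "a * Re x"] f[OF x] that by (simp add: norm_mult norm_power)
  qed
  have disc: "cmod (f x) \<le> B" if "cmod x \<le> 1" for x
  proof (rule maximum_modulus_frontier[of f "cball 0 1"])
    show "f holomorphic_on interior (cball 0 1)" unfolding f_def by (intro holomorphic_intros)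
    show "continuous_on (closure (cball 0 1)) f" unfolding f_def by (intro continuous_intros)
  qed (use that circle in auto)
  have z0: "z \<noteq> 0" using z by auto
  have "cmod (f (1 / z)) \<le> B" using z z0 by (intro disc) (simp add: norm_divide)
  moreover have "f (1 / z) = (1 / z) ^ n * poly p (J z)"
    using f[of "1 / z"] z0 by (simp add: J_def add.commute)
  ultimately have "cmod (poly p (J z)) / cmod z ^ n \<le> B"
    by (simp add: norm_mult norm_power norm_divide power_divide)
  then show ?thesis using z0 by (simp add: J_def n_def field_simps)
qed

subsection \<open>Zeros of polynomials with small norm\<close>

text \<open>Constants independent of \<open>n\<close> disappear on taking \<open>n\<close>-th roots.
  This is how all the approximations by finite products are made exact.\<close>

lemma le_of_eventually_power_le:
  fixes x y :: real
  assumes "k > 0" "x \<ge> 0" "y \<ge> 0" and ev: "\<forall>\<^sub>F n in sequentially. k * x ^ n \<le> K * y ^ n"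
  shows "x \<le> y"
proof (rule ccontr)
  assume "\<not> x \<le> y"
  then have xy: "y < x" "0 < x" using assms by auto
  then have "(\<lambda>n. (y / x) ^ n) \<longlonglongrightarrow> 0"
    using assms by (intro LIMSEQ_realpow_zero) auto
  then have "(\<lambda>n. K * (y / x) ^ n) \<longlonglongrightarrow> K * 0" by (intro tendsto_mult tendsto_const)
  then have "\<forall>\<^sub>F n in sequentially. K * (y / x) ^ n < k"
    using assms by (intro order_tendstoD) auto
  with ev have "\<forall>\<^sub>F n in sequentially. False"
  proof eventually_elim
    case (elim n)
    have "k * x ^ n \<le> (K * (y / x) ^ n) * x ^ n"
      using elim(1) xy by (simp add: power_divide)
    also have "\<dots> < k * x ^ n" using elim(2) xy by (intro mult_strict_right_mono) auto
    finally show ?case by simp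
  qed
  then show False by simp
qed

lemma le_exp_of_le_exp_plus:
  fixes x :: real
  assumes "\<And>e. e > 0 \<Longrightarrow> x \<le> K * exp (c * (F + e))"
  shows "x \<le> K * exp (c * F)"
proof (rule tendsto_lowerbound)
  show "((\<lambda>e. K * exp (c * (F + e))) \<longlongrightarrow> K * exp (c * F)) (at_right 0)"
    by (auto intro!: tendsto_eq_intros)
  show "\<forall>\<^sub>F e in at_right 0. x \<le> K * exp (c * (F + e))"
    using assms by (auto simp: eventually_at_filter)
qed simp

lemma cmod_real_power_minus_i_le:
  "cmod (of_real x ^ N - \<i>) \<le> sqrt 2 * max 1 \<bar>x\<bar> ^ N"
proof -
  have m: "1 \<le> max 1 \<bar>x\<bar> ^ N" "\<bar>x\<bar> ^ N \<le> max 1 \<bar>x\<bar> ^ N"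
    by (auto intro: one_le_power power_mono)
  have "(x ^ N)\<^sup>2 + 1 = (\<bar>x\<bar> ^ N)\<^sup>2 + 1\<^sup>2" by (simp flip: power_abs)
  also have "\<dots> \<le> (max 1 \<bar>x\<bar> ^ N)\<^sup>2 + (max 1 \<bar>x\<bar> ^ N)\<^sup>2"
    using m by (intro add_mono power_mono) auto
  finally have "sqrt ((x ^ N)\<^sup>2 + 1) \<le> sqrt (2 * (max 1 \<bar>x\<bar> ^ N)\<^sup>2)" by simp
  also have "\<dots> = sqrt 2 * max 1 \<bar>x\<bar> ^ N" by (simp add: real_sqrt_mult)
  also have "sqrt ((x ^ N)\<^sup>2 + 1) = cmod (of_real x ^ N - \<i>)"
    by (simp add: cmod_def flip: of_real_power)
  finally show ?thesis .
qed

text \<open>Here \<open>ln (cmod z)\<close> is the Green function of the complement of the segment at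
  \<open>a * (z + 1 / z) / 2\<close>, and the product runs over the points \<open>u + x\<close> with \<open>x ^ N = \<i>\<close>. The Green
  function is approximated by \<open>ln\<close> of polynomials with roots \<open>a * cos (2 * pi * i / M)\<close>; exchanging
  the two products turns the product over the circle into \<open>(t - u) ^ N - \<i>\<close> for each root \<open>t\<close>.
  The value \<open>\<i>\<close> (rather than 1) keeps the circle points off the real line.\<close>

lemma prod_joukowski_circle_le:
  assumes a: "a > 0" and u: "u \<in> {-a..a}" and N: "N \<ge> 1" and c: "c ^ N = \<i>"
    and z: "\<And>k. k < N \<Longrightarrow> cmod (z k) > 1"
    and w: "\<And>k. k < N \<Longrightarrow> of_real u + c * cis (2 * pi * real k / real N) = of_real a * (z k + 1 / z k) / 2"
  shows "(\<Prod>k<N. cmod (z k)) \<le> (2 / a) ^ N * sqrt 2 * exp (real N * mean_potential a)"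
proof (rule le_exp_of_le_exp_plus)
  fix e :: real assume e: "e > 0"
  define Z where "Z = (\<Prod>k<N. cmod (z k))"
  \<comment> \<open>\<open>b\<close> collects the loss in bounding \<open>cmod (z k ^ M - 1)\<close>
    from below by a multiple of \<open>cmod (z k) ^ M\<close>. It does not depend on
    \<open>M\<close>, so it is harmless once \<open>M\<close>-th roots are taken.\<close>
  define b where "b = (\<Prod>k<N. (1 - 1 / cmod (z k))\<^sup>2)"
  define t where "t = (\<lambda>M i. a * cos (2 * pi * real i / real M))"
  have b: "b > 0" unfolding b_def using z by (intro prod_pos) (force simp: field_simps)
  let ?R = "(2 / a) ^ N * sqrt 2 * exp (real N * (mean_potential a + e))"
  have node: "cmod ((of_real (t M i) - of_real u) ^ N - \<i>) = (\<Prod>k<N. cmod (of_real a * (z k + 1 / z k) / 2 - of_real (t M i)))" for M i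
  proof -
    have "(of_real (t M i) - of_real u) ^ N - \<i> = (\<Prod>k<N. of_real (t M i) - of_real u - c * cis (2 * pi * real k / real N))"
      using prod_diff_roots_of_unity[OF N] c by simp
    then have "cmod ((of_real (t M i) - of_real u) ^ N - \<i>) = (\<Prod>k<N. cmod (of_real (t M i) - (of_real u + c * cis (2 * pi * real k / real N))))"
      by (simp add: prod_norm diff_diff_eq)
    also have "\<dots> = (\<Prod>k<N. cmod (of_real a * (z k + 1 / z k) / 2 - of_real (t M i)))"
      using w by (intro prod.cong refl) (metis lessThan_iff norm_minus_commute)
    finally show ?thesis .
  qed
  have main: "b * Z ^ M \<le> (\<Prod>i<M. (2 / a) ^ N * sqrt 2 * max 1 \<bar>t M i - u\<bar> ^ N)" if M: "M \<ge> 1" for M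
  proof -
    have "b * Z ^ M = (\<Prod>k<N. (1 - 1 / cmod (z k))\<^sup>2 * cmod (z k) ^ M)"
      by (simp add: b_def Z_def prod.distrib prod_power_distrib)
    also have "\<dots> \<le> (\<Prod>k<N. \<Prod>i<M. 2 / a * cmod (of_real a * (z k + 1 / z k) / 2 - of_real (t M i)))"
    proof (rule prod_mono, intro conjI)
      fix k assume "k \<in> {..<N}"
      then have zk: "cmod (z k) > 1" and nz: "z k \<noteq> 0" using z[of k] by auto
      let ?r = "cmod (z k)"
      have "1 / ?r \<le> 1" using zk by (subst divide_le_eq_1_pos) linarith+
      obtain m where m: "M = Suc m" using M by (cases M) auto
      have "?r ^ M * (1 - 1 / ?r) = ?r ^ M - ?r ^ m" using nz by (simp add: m right_diff_distrib)
      \<comment> \<open>Here \<open>?r ^ m \<ge> 1\<close>, since \<open>?r > 1\<close>.\<close>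
      also have "\<dots> \<le> cmod (z k ^ M) - cmod 1" using zk by (simp add: norm_power)
      also have "\<dots> \<le> cmod (z k ^ M - 1)" by (rule norm_triangle_ineq2)
      finally have "(?r ^ M * (1 - 1 / ?r))\<^sup>2 \<le> (cmod (z k ^ M - 1))\<^sup>2"
        using \<open>1 / ?r \<le> 1\<close> by (intro power_mono mult_nonneg_nonneg) auto
      also have "\<dots> = cmod (z k ^ M * (\<Prod>i<M. 2 / of_real a * (of_real a * (z k + 1 / z k) / 2 - of_real (t M i))))"
        unfolding t_def by (subst joukowski_prod[OF nz a M]) (simp add: norm_power)
      also have "\<dots> = ?r ^ M * (\<Prod>i<M. 2 / a * cmod (of_real a * (z k + 1 / z k) / 2 - of_real (t M i)))"
        unfolding norm_mult norm_power prod_norm[symmetric] using a by (simp add: norm_divide norm_mult)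
      \<comment> \<open>One of the two powers \<open>?r ^ M\<close> cancels against the power of
        \<open>z\<close> in the Joukowski identity.\<close>
      finally have "?r ^ M * ((1 - 1 / ?r)\<^sup>2 * ?r ^ M) \<le> ?r ^ M * (\<Prod>i<M. 2 / a * cmod (of_real a * (z k + 1 / z k) / 2 - of_real (t M i)))"
        by (simp only: power_mult_distrib power2_eq_square mult_ac)
      then show "(1 - 1 / ?r)\<^sup>2 * ?r ^ M \<le> (\<Prod>i<M. 2 / a * cmod (of_real a * (z k + 1 / z k) / 2 - of_real (t M i)))"
        using nz by (subst (asm) mult_le_cancel_left_pos) auto
    qed auto
    also have "\<dots> = (\<Prod>i<M. (2 / a) ^ N * cmod ((of_real (t M i) - of_real u) ^ N - \<i>))"
      by (subst prod.swap) (simp only: node prod.distrib prod_constant card_lessThan)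
    also have "\<dots> \<le> (\<Prod>i<M. (2 / a) ^ N * (sqrt 2 * max 1 \<bar>t M i - u\<bar> ^ N))"
      using a cmod_real_power_minus_i_le[of "t M _ - u" N]
      by (intro prod_mono conjI mult_left_mono mult_nonneg_nonneg) (auto simp: of_real_diff)
    finally show ?thesis by (simp add: mult.assoc)
  qed
  have "\<forall>\<^sub>F M in sequentially. b * Z ^ M \<le> 1 * ?R ^ M"
    using eventually_sum_ln_dist_le[OF a u e] eventually_ge_at_top[of 1]
  proof eventually_elim
    case (elim M)
    have "max 1 \<bar>t M i - u\<bar> ^ N = exp (real N * ln (max 1 \<bar>t M i - u\<bar>))" for i
      by (subst exp_of_nat_mult) (simp add: max_def)
    then have "(\<Prod>i<M. max 1 \<bar>t M i - u\<bar> ^ N) = exp (real N * (\<Sum>i<M. ln (max 1 \<bar>t M i - u\<bar>)))"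
      by (simp add: exp_sum sum_distrib_left)
    also have "\<dots> \<le> exp (real N * (real M * (mean_potential a + e)))"
      using elim by (auto simp: t_def intro!: mult_left_mono)
    also have "\<dots> = exp (real N * (mean_potential a + e)) ^ M"
      by (simp add: exp_of_nat_mult[symmetric] mult_ac)
    finally have *: "(\<Prod>i<M. max 1 \<bar>t M i - u\<bar> ^ N) \<le> exp (real N * (mean_potential a + e)) ^ M" .
    have "b * Z ^ M \<le> ((2 / a) ^ N * sqrt 2) ^ M * (\<Prod>i<M. max 1 \<bar>t M i - u\<bar> ^ N)"
      using main[OF elim(2)] by (simp only: prod.distrib prod_constant card_lessThan power_mult_distrib)
    also have "\<dots> \<le> ((2 / a) ^ N * sqrt 2) ^ M * exp (real N * (mean_potential a + e)) ^ M"
      using a by (intro mult_left_mono *) auto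
    finally show ?case by (simp add: power_mult_distrib)
  qed
  then show "Z \<le> ?R"
    using a z b by (intro le_of_eventually_power_le[of b Z ?R 1]) (auto simp: Z_def intro!: prod_nonneg)
qed

text \<open>With \<open>s = cmod (z - u)\<close>, the distance from \<open>(z - u) ^ N\<close> to
  \<open>\<i>\<close> is at least \<open>\<bar>s ^ N - 1\<bar>\<close>. For
  \<open>s \<noteq> 1\<close> this is at least a positive constant times \<open>max 1 s ^ N\<close>:
  the constant is \<open>1 - s\<close> if \<open>s < 1\<close> and \<open>1 - 1 / s\<close> if
  \<open>s > 1\<close>. Multiplying over \<open>X\<close> gives a \<open>b\<close> independent of
  \<open>N\<close>.\<close>

lemma ex_power_minus_i_ge:
  assumes "\<And>z. z \<in># X \<Longrightarrow> cmod (z - u) \<noteq> 1"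
  shows "\<exists>b>0. \<forall>N\<ge>1. b * (\<Prod>z\<in>#X. max 1 (cmod (z - u))) ^ N \<le> (\<Prod>z\<in>#X. cmod ((z - u) ^ N - \<i>))"
  using assms
proof (induction X)
  case empty
  then show ?case by (intro exI[of _ 1]) auto
next
  case (add z X)
  then obtain b where b: "b > 0"
    "\<And>N. N \<ge> 1 \<Longrightarrow> b * (\<Prod>z\<in>#X. max 1 (cmod (z - u))) ^ N \<le> (\<Prod>z\<in>#X. cmod ((z - u) ^ N - \<i>))"
    by fastforce
  let ?s = "cmod (z - u)"
  have tri: "\<bar>?s ^ N - 1\<bar> \<le> cmod ((z - u) ^ N - \<i>)" for N
    using norm_triangle_ineq3[of "(z - u) ^ N" \<i>] by (simp add: norm_power)
  have "\<exists>d>0. \<forall>N\<ge>1. d * max 1 ?s ^ N \<le> cmod ((z - u) ^ N - \<i>)"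
  proof (cases "?s < 1")
    case True
    have "(1 - ?s) * max 1 ?s ^ N \<le> cmod ((z - u) ^ N - \<i>)" if "N \<ge> 1" for N
    proof -
      have "?s ^ N \<le> ?s ^ 1" using True that by (intro power_decreasing) auto
      then show ?thesis using True tri[of N] by (simp add: max_absorb1)
    qed
    then show ?thesis using True by (intro exI[of _ "1 - ?s"]) auto
  next
    case False
    then have s: "?s > 1" using add.prems[of z] by auto
    have "(1 - 1 / ?s) * max 1 ?s ^ N \<le> cmod ((z - u) ^ N - \<i>)" if "N \<ge> 1" for N
    proof -
      obtain m where m: "N = Suc m" using \<open>N \<ge> 1\<close> by (cases N) auto
      have "(1 - 1 / ?s) * max 1 ?s ^ N = ?s ^ N - ?s ^ m"
        using s by (auto simp: m max_absorb2 left_diff_distrib)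
      also have "\<dots> \<le> ?s ^ N - 1" using s by simp
      finally show ?thesis using tri[of N] by linarith
    qed
    moreover have "1 - 1 / ?s > 0" using s by (subst diff_gt_0_iff_gt, subst divide_less_eq_1) auto
    ultimately show ?thesis by blast
  qed
  then obtain d where d: "d > 0" "\<And>N. N \<ge> 1 \<Longrightarrow> d * max 1 ?s ^ N \<le> cmod ((z - u) ^ N - \<i>)" by blast
  have nn: "0 \<le> (\<Prod>z\<in>#Y. max 1 (cmod (z - u)))" for Y by (induction Y) auto
  show ?case
  proof (intro exI[of _ "d * b"] conjI allI impI)
    show "0 < d * b" using b d by simp
    fix N :: nat assume N: "N \<ge> 1"
    have "(d * max 1 ?s ^ N) * (b * (\<Prod>z\<in>#X. max 1 (cmod (z - u))) ^ N)
      \<le> cmod ((z - u) ^ N - \<i>) * (\<Prod>z\<in>#X. cmod ((z - u) ^ N - \<i>))"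
      using b(1) nn by (intro mult_mono d(2) b(2) N) auto
    then show "d * b * (\<Prod>z\<in>#add_mset z X. max 1 (cmod (z - u))) ^ N
      \<le> (\<Prod>z\<in>#add_mset z X. cmod ((z - u) ^ N - \<i>))"
      by (simp add: power_mult_distrib mult_ac)
  qed
qed

lemma poly_monic_eq_prod_proots:
  fixes p :: "complex poly"
  assumes "monic_poly p"
  shows "poly p x = (\<Prod>z\<in>#proots p. x - z)"
proof -
  have "p = (\<Prod>z\<in>#proots p. [:-z, 1:])"
    using complex_poly_decompose_multiset[of p] assms by (simp add: monic_poly_def)
  then have "poly p x = poly (\<Prod>z\<in>#proots p. [:-z, 1:]) x" by simp
  also have "\<dots> = (\<Prod>z\<in>#proots p. x - z)"
    by (simp add: poly_prod_mset image_mset.compositionality o_def)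
  finally show ?thesis .
qed

lemma power_rearrange:
  fixes b x y s :: real
  shows "b ^ N * (x ^ N * s * y ^ N) ^ n = s ^ n * (b * (x * y) ^ n) ^ N"
  by (simp add: power_mult_distrib power_mult[symmetric] mult_ac)

text \<open>This is a discrete Jensen formula. The product of
  \<open>cmod ((z - u) ^ N - \<i>)\<close> over the zeros equals the product of
  \<open>cmod (poly p (W k))\<close> over \<open>N\<close> points of the unit circle around
  \<open>u\<close>. The former is bounded below by \<open>ex_power_minus_i_ge\<close>, the latter
  above by Bernstein--Walsh and \<open>prod_joukowski_circle_le\<close>; then \<open>N\<close>-th
  roots are taken.\<close>

lemma prod_max_proots_le:
  assumes a: "a > 0" and u: "u \<in> {-a..a}" and p: "monic_poly p"
    and bound: "\<And>t. t \<in> {-a..a} \<Longrightarrow> cmod (poly p (of_real t)) \<le> B"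
    and generic: "\<And>z. z \<in># proots p \<Longrightarrow> cmod (z - of_real u) \<noteq> 1"
  shows "(\<Prod>z\<in>#proots p. max 1 (cmod (z - of_real u))) \<le> B * (2 / a * exp (mean_potential a)) ^ degree p"
proof -
  define n where "n = degree p"
  let ?A = "\<Prod>z\<in>#proots p. max 1 (cmod (z - of_real u))"
  have B: "B \<ge> 0" using bound[OF u] norm_ge_zero order_trans by blast
  obtain b where b: "b > 0"
    "\<And>N. N \<ge> 1 \<Longrightarrow> b * ?A ^ N \<le> (\<Prod>z\<in>#proots p. cmod ((z - of_real u) ^ N - \<i>))"
    using ex_power_minus_i_ge[OF generic] by blast
  have "b * ?A ^ N \<le> sqrt 2 ^ n * (B * (2 / a * exp (mean_potential a)) ^ n) ^ N" if N: "N \<ge> 1" for N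
  proof -
    define c where "c = cis (pi / (2 * real N))"
    define W where "W = (\<lambda>k. of_real u + c * cis (2 * pi * real k / real N))"
    have "c ^ N = cis (real N * (pi / (2 * real N)))" unfolding c_def by (rule Complex.DeMoivre)
    then have c: "c ^ N = \<i>" using N by simp
    \<comment> \<open>\<open>(W k - u) ^ N = \<i>\<close> rules out real \<open>W k\<close>, so each
      \<open>W k\<close> has a Joukowski preimage strictly outside the unit circle.\<close>
    have nonreal: "W k \<notin> \<real>" for k
    proof
      assume "W k \<in> \<real>"
      then have "W k - of_real u \<in> \<real>" by (intro Reals_diff) auto
      then have "(W k - of_real u) ^ N \<in> \<real>" by (rule Reals_power)
      moreover have "(W k - of_real u) ^ N = \<i>"
      proof -
        have "cis (2 * pi * real k / real N) ^ N = cis (2 * pi * real k)"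
          using N by (subst Complex.DeMoivre) simp
        then show ?thesis using c by (simp add: W_def power_mult_distrib)
      qed
      ultimately show False by (simp add: complex_is_Real_iff)
    qed
    have "\<exists>z. cmod z > 1 \<and> W k = of_real a * (z + 1 / z) / 2" for k
      using ex_joukowski[OF a nonreal[of k]] by metis
    then obtain z where z: "\<And>k. cmod (z k) > 1" "\<And>k. W k = of_real a * (z k + 1 / z k) / 2" by metis
    have Z: "(\<Prod>k<N. cmod (z k)) \<le> (2 / a) ^ N * sqrt 2 * exp (real N * mean_potential a)"
      using z(1) by (intro prod_joukowski_circle_le[OF a u N c]) (auto simp: z(2)[symmetric] W_def)
    have "cmod ((x - of_real u) ^ N - \<i>) = (\<Prod>k<N. cmod (W k - x))" for x
    proof -
      have "(x - of_real u) ^ N - \<i> = (\<Prod>k<N. x - of_real u - c * cis (2 * pi * real k / real N))"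
        using prod_diff_roots_of_unity[OF N] c by simp
      then have "cmod ((x - of_real u) ^ N - \<i>) = (\<Prod>k<N. cmod (x - W k))"
        by (simp add: prod_norm diff_diff_eq W_def)
      then show ?thesis by (simp add: norm_minus_commute)
    qed
    then have "(\<Prod>x\<in>#proots p. cmod ((x - of_real u) ^ N - \<i>)) = (\<Prod>x\<in>#proots p. \<Prod>k<N. cmod (W k - x))"
      by simp
    also have "\<dots> = (\<Prod>k<N. \<Prod>x\<in>#proots p. cmod (W k - x))"
    proof -
      have "(\<Prod>x\<in>#X. \<Prod>k<N. cmod (W k - x)) = (\<Prod>k<N. \<Prod>x\<in>#X. cmod (W k - x))" for X
        by (induction X) (auto simp: prod.distrib)
      then show ?thesis .
    qed
    also have "\<dots> = (\<Prod>k<N. cmod (poly p (W k)))"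
    proof (rule prod.cong)
      fix k
      have "cmod (\<Prod>x\<in>#X. y - x) = (\<Prod>x\<in>#X. cmod (y - x))" for X and y :: complex
        by (induction X) (auto simp: norm_mult)
      then show "(\<Prod>x\<in>#proots p. cmod (W k - x)) = cmod (poly p (W k))"
        by (simp add: poly_monic_eq_prod_proots[OF p])
    qed simp
    also have "\<dots> \<le> (\<Prod>k<N. B * cmod (z k) ^ n)"
      unfolding z(2) n_def using z(1) by (intro prod_mono conjI bernstein_walsh_segment[OF a bound]) (auto intro: less_imp_le)
    also have "\<dots> = B ^ N * (\<Prod>k<N. cmod (z k)) ^ n"
      by (simp add: prod.distrib prod_power_distrib)
    also have "\<dots> \<le> B ^ N * ((2 / a) ^ N * sqrt 2 * exp (real N * mean_potential a)) ^ n"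
      using B by (intro mult_left_mono power_mono Z prod_nonneg) auto
    also have "\<dots> = sqrt 2 ^ n * (B * (2 / a * exp (mean_potential a)) ^ n) ^ N"
    proof -
      have "exp (real N * mean_potential a) = exp (mean_potential a) ^ N"
        by (fact exp_of_nat_mult)
      then have "B ^ N * ((2 / a) ^ N * sqrt 2 * exp (real N * mean_potential a)) ^ n
        = B ^ N * ((2 / a) ^ N * sqrt 2 * exp (mean_potential a) ^ N) ^ n"
        by (rule arg_cong)
      also have "\<dots> = sqrt 2 ^ n * (B * (2 / a * exp (mean_potential a)) ^ n) ^ N"
        by (rule power_rearrange)
      finally show ?thesis .
    qed
    finally show ?thesis using b(2)[OF N] by linarith
  qed
  then have "\<forall>\<^sub>F N in sequentially. b * ?A ^ N \<le> sqrt 2 ^ n * (B * (2 / a * exp (mean_potential a)) ^ n) ^ N"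
    by (rule eventually_sequentiallyI)
  moreover have "(\<Prod>z\<in>#X. max 1 (cmod (z - of_real u))) \<ge> 0" for X by (induction X) auto
  ultimately show ?thesis
    unfolding n_def[symmetric] using a b(1) B
    by (intro le_of_eventually_power_le[where k = b and x = ?A and K = "sqrt 2 ^ n"]) auto
qed

subsection \<open>The factor constant\<close>

lemma bdd_above_cmod_poly_segment:
  "bdd_above ((\<lambda>z. cmod (poly p z)) ` real_segment a)"
proof -
  have "compact ((\<lambda>z. cmod (poly p z)) ` real_segment a)"
    unfolding real_segment_def image_image
    by (intro compact_continuous_image continuous_intros) auto
  then show ?thesis by (intro bounded_imp_bdd_above compact_imp_bounded)
qed

lemma cmod_poly_le_sup_norm:
  assumes "t \<in> {-a..a}"
  shows "cmod (poly p (of_real t)) \<le> sup_norm_on (real_segment a) (poly p)"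
  unfolding sup_norm_on_def
  by (rule cSUP_upper[OF _ bdd_above_cmod_poly_segment]) (use assms in \<open>auto simp: real_segment_def\<close>)

lemma sup_norm_le:
  assumes "a > 0" "\<And>t. t \<in> {-a..a} \<Longrightarrow> cmod (poly p (of_real t)) \<le> B"
  shows "sup_norm_on (real_segment a) (poly p) \<le> B"
  unfolding sup_norm_on_def
  by (rule cSUP_least) (use assms in \<open>auto simp: real_segment_def\<close>)

lemma finite_real_dist_eq_one: "finite {u::real. cmod (z - of_real u) = 1}"
proof (rule finite_subset)
  define s where "s = sqrt (1 - (Im z)\<^sup>2)"
  show "{u::real. cmod (z - of_real u) = 1} \<subseteq> {Re z - s, Re z + s}"
  proof
    fix u :: real assume "u \<in> {u. cmod (z - of_real u) = 1}"
    then have "(Re z - u)\<^sup>2 + (Im z)\<^sup>2 = 1" by (simp add: cmod_def)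
    then have "(Re z - u)\<^sup>2 = 1 - (Im z)\<^sup>2" by linarith
    then have "\<bar>Re z - u\<bar> = s" unfolding s_def by (metis real_sqrt_abs)
    then show "u \<in> {Re z - s, Re z + s}" by auto
  qed
qed simp

text \<open>Each factor \<open>cmod (u - z)\<close> with \<open>z\<close> a zero of \<open>q\<close>
  is at most \<open>max 1 (cmod (z - u))\<close>, and the zeros of \<open>r\<close> only contribute
  further factors that are at least 1, so the product over all zeros of \<open>q * r\<close> is an
  upper bound.\<close>

lemma cmod_factor_le:
  assumes a: "a > 0" and q: "monic_poly q" and r: "monic_poly r" and u: "u \<in> {-a..a}"
  shows "cmod (poly q (of_real u))
    \<le> (2 / a * exp (mean_potential a)) ^ degree (q * r) * sup_norm_on (real_segment a) (poly (q * r))"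
    (is "_ \<le> ?B")
proof -
  have nz: "q \<noteq> 0" "r \<noteq> 0" using q r by (auto simp: monic_poly_def)
  have p: "monic_poly (q * r)" using q r by (simp add: monic_poly_def lead_coeff_mult)
  define S where "S = (\<Union>z\<in>set_mset (proots (q * r)). {u::real. cmod (z - of_real u) = 1})"
  have fin: "finite S" unfolding S_def by (intro finite_UN_I finite_real_dist_eq_one) auto
  \<comment> \<open>Off the finite set \<open>S\<close> the powers \<open>(z - u) ^ N\<close> stay away from the unit circle.\<close>
  have generic: "cmod (poly q (of_real v)) \<le> ?B" if v: "v \<in> {-a..a} - S" for v
  proof -
    let ?P = "\<lambda>X. \<Prod>z\<in>#X. max 1 (cmod (z - of_real v))"
    have off_circle: "cmod (z - of_real v) \<noteq> 1" if "z \<in># proots (q * r)" for z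
      using v that unfolding S_def by blast
    have ge1: "?P X \<ge> 1" for X by (induction X) (auto intro: mult_ge1_I)
    have "cmod (\<Prod>z\<in>#X. of_real v - z) \<le> ?P X" for X
    proof (induction X)
      case (add z X)
      then show ?case by (auto simp: norm_mult norm_minus_commute intro!: mult_mono)
    qed simp
    then have "cmod (poly q (of_real v)) \<le> ?P (proots q)"
      by (simp add: poly_monic_eq_prod_proots[OF q])
    also have "\<dots> \<le> ?P (proots q) * ?P (proots r)"
      using ge1[of "proots q"] ge1[of "proots r"] by (simp add: mult_le_cancel_left1)
    also have "\<dots> = ?P (proots (q * r))" using nz by (simp add: proots_mult)
    also have "\<dots> \<le> sup_norm_on (real_segment a) (poly (q * r)) * (2 / a * exp (mean_potential a)) ^ degree (q * r)"
      using v off_circle by (intro prod_max_proots_le[OF a _ p cmod_poly_le_sup_norm]) auto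
    finally show ?thesis by (simp add: mult.commute)
  qed
  \<comment> \<open>Removing the finite set \<open>S\<close> leaves a dense subset of the segment,
    so the bound extends to every \<open>u\<close> by continuity of \<open>poly q\<close>.\<close>
  have "u islimpt {-a..a}"
    using a u by (simp add: islimpt_Icc)
  then have "u islimpt (S \<union> ({-a..a} - S))"
    by (rule islimpt_subset) auto
  then have "u islimpt ({-a..a} - S)"
    by (simp only: islimpt_Un_finite[OF fin])
  then have "u \<in> closure ({-a..a} - S)" by (simp add: closure_def)
  then show ?thesis
    by (rule continuous_le_on_closure[rotated]) (rule generic, assumption | intro continuous_intros)+
qed

lemma factor_constant_segment:
  assumes "a > 0"
  shows "factor_constant (real_segment a) (2 / a * exp (mean_potential a))"
  unfolding factor_constant_def monic_factor_def
proof (intro allI impI)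
  fix n p q
  assume p: "degree p = n" and "monic_poly q \<and> (\<exists>r. monic_poly r \<and> p = q * r)"
  then obtain r where "monic_poly q" "monic_poly r" "p = q * r" by blast
  with cmod_factor_le[OF assms this(1,2)] p
  show "sup_norm_on (real_segment a) (poly q)
      \<le> (2 / a * exp (mean_potential a)) ^ n * sup_norm_on (real_segment a) (poly p)"
    by (intro sup_norm_le[OF assms]) simp
qed

text \<open>With \<open>z = cis s\<close>, the monic polynomial with roots \<open>a * cos (2 * pi * k / M)\<close> has modulus
  \<open>(a / 2) ^ M * (cmod (z ^ M - 1))\<^sup>2\<close> at \<open>a * cos s\<close>; the factor keeps the roots at
  distance at least 1 from the endpoint \<open>a\<close>.\<close>

lemma ex_extremal_factor:
  assumes a: "a > 0" and M: "M \<ge> 1"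
  obtains p q where "monic_poly p" "degree p = M" "monic_factor q p"
    "sup_norm_on (real_segment a) (poly p) \<le> 4 * (a / 2) ^ M"
    "sup_norm_on (real_segment a) (poly q) \<ge> exp (\<Sum>k<M. endpoint_potential a (2 * pi * real k / real M))"
proof -
  define t where "t = (\<lambda>k. a * cos (2 * pi * real k / real M))"
  define Q :: "nat set \<Rightarrow> complex poly" where "Q = (\<lambda>K. \<Prod>k\<in>K. [:- of_real (t k), 1:])"
  define I where "I = {k. k < M \<and> 1 \<le> a - t k}"
  have monic: "monic_poly (Q K)" for K unfolding Q_def monic_poly_def by (subst lead_coeff_prod) simp
  have Q: "cmod (poly (Q K) x) = (\<Prod>k\<in>K. cmod (x - of_real (t k)))" for K x
    by (simp add: Q_def poly_prod prod_norm)
  have t: "t k \<le> a" for k using a by (simp add: t_def)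
  have factor: "monic_factor (Q I) (Q {..<M})"
    unfolding monic_factor_def
  proof (intro conjI exI)
    show "Q {..<M} = Q I * Q ({..<M} - I)"
      unfolding Q_def by (subst mult.commute, rule prod.subset_diff) (auto simp: I_def)
  qed (use monic in auto)
  have "cmod (poly (Q {..<M}) (of_real u)) \<le> 4 * (a / 2) ^ M" if u: "u \<in> {-a..a}" for u
  proof -
    define z where "z = cis (arccos (u / a))"
    have z: "z \<noteq> 0" "cmod z = 1" by (auto simp: z_def)
    have inv: "1 / z = cnj z" by (simp add: z_def cis_cnj inverse_eq_divide[symmetric])
    have "a * cos (arccos (u / a)) = u" using a u by (simp add: cos_arccos field_simps)
    then have J: "of_real a * (z + 1 / z) / 2 = of_real u"
      unfolding inv by (simp add: complex_eq_iff z_def)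
    have "(cmod (z ^ M - 1))\<^sup>2 = cmod (z ^ M * (\<Prod>k<M. 2 / of_real a * (of_real u - of_real (t k))))"
      using joukowski_prod[OF z(1) a M] by (simp add: J t_def norm_power)
    also have "\<dots> = (2 / a) ^ M * cmod (poly (Q {..<M}) (of_real u))"
      unfolding norm_mult norm_power Q prod_norm[symmetric] prod.distrib prod_constant card_lessThan
      using a z by (simp add: norm_divide)
    finally have "cmod (poly (Q {..<M}) (of_real u)) = (cmod (z ^ M - 1))\<^sup>2 * (a / 2) ^ M"
      using a by (simp add: power_divide)
    also have "cmod (z ^ M - 1) \<le> 2"
      using norm_triangle_ineq4[of "z ^ M" 1] z by (simp add: norm_power)
    then have "(cmod (z ^ M - 1))\<^sup>2 * (a / 2) ^ M \<le> 2\<^sup>2 * (a / 2) ^ M"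
      using a by (intro mult_right_mono power_mono) auto
    finally show ?thesis by simp
  qed
  then have norm_p: "sup_norm_on (real_segment a) (poly (Q {..<M})) \<le> 4 * (a / 2) ^ M"
    by (rule sup_norm_le[OF a])
  have "exp (\<Sum>k<M. endpoint_potential a (2 * pi * real k / real M)) = (\<Prod>k<M. max 1 (a - t k))"
    by (simp add: exp_sum endpoint_potential_def t_def max_def)
  \<comment> \<open>The nodes outside \<open>I\<close> are closer than 1 to \<open>a\<close> and
    contribute the factor 1.\<close>
  also have "\<dots> = (\<Prod>k\<in>I. max 1 (a - t k))"
    by (rule prod.mono_neutral_right) (auto simp: I_def)
  also have "\<dots> = cmod (poly (Q I) (of_real a))"
    unfolding Q using t by (intro prod.cong) (auto simp: I_def simp flip: of_real_diff)
  also have "\<dots> \<le> sup_norm_on (real_segment a) (poly (Q I))"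
    using a by (intro cmod_poly_le_sup_norm) auto
  finally have norm_q: "sup_norm_on (real_segment a) (poly (Q I)) \<ge> exp (\<Sum>k<M. endpoint_potential a (2 * pi * real k / real M))" .
  have "degree (Q {..<M}) = M" unfolding Q_def by (subst degree_prod_sum_eq) auto
  from that[OF monic this factor norm_p norm_q] show ?thesis .
qed

text \<open>For the extremal pairs of degree \<open>M\<close>, the \<open>M\<close>-th root of the
  ratio of the two norms is at least a quantity tending to
  \<open>2 / a * exp (mean_potential a)\<close>; the factor 4 in the norm of \<open>p\<close>
  disappears in the limit.\<close>

lemma factor_constant_segment_ge:
  assumes a: "a > 0" and C: "factor_constant (real_segment a) C"
  shows "2 / a * exp (mean_potential a) \<le> C"
proof -
  let ?s = "\<lambda>M. \<Sum>k<M. endpoint_potential a (2 * pi * real k / real M)"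
  have norm_nonneg: "sup_norm_on (real_segment a) (poly p) \<ge> 0" for p
    using order_trans[OF norm_ge_zero cmod_poly_le_sup_norm[of 0 a p]] a by simp
  have key: "\<exists>B\<ge>0. B \<le> 4 * (a / 2) ^ M \<and> exp (?s M) \<le> C ^ M * B" if M: "M \<ge> 1" for M
  proof -
    obtain p q where pq: "monic_poly p" "degree p = M" "monic_factor q p"
      "sup_norm_on (real_segment a) (poly p) \<le> 4 * (a / 2) ^ M"
      "sup_norm_on (real_segment a) (poly q) \<ge> exp (?s M)"
      using ex_extremal_factor[OF a M] .
    then have "sup_norm_on (real_segment a) (poly q) \<le> C ^ M * sup_norm_on (real_segment a) (poly p)"
      using C M unfolding factor_constant_def by blast
    then show ?thesis using pq norm_nonneg[of p] by (intro exI[of _ "sup_norm_on (real_segment a) (poly p)"]) auto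
  qed
  \<comment> \<open>The sign of \<open>C\<close> is not part of \<open>factor_constant\<close>; it
    comes from degree 1, where \<open>C * B\<close> must be positive.\<close>
  obtain B where "B \<ge> 0" "exp (?s 1) \<le> C * B" using key[of 1] by auto
  then have "C \<ge> 0"
    using mult_nonpos_nonneg[of C B] exp_gt_zero[of "?s 1"] by linarith
  have pot: "(\<lambda>M. ?s M / real M) \<longlonglongrightarrow> mean_potential a"
    using mean_endpoint_potential_tendsto[of a 0] by simp
  have "exp (mean_potential a - e) \<le> C * a / 2" if "e > 0" for e
  proof (rule le_of_eventually_power_le[of 1])
    have "\<forall>\<^sub>F M in sequentially. mean_potential a - e < ?s M / real M"
      using \<open>e > 0\<close> by (intro order_tendstoD(1)[OF pot]) auto
    then show "\<forall>\<^sub>F M in sequentially. 1 * exp (mean_potential a - e) ^ M \<le> 4 * (C * a / 2) ^ M"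
      using eventually_ge_at_top[of 1]
    proof eventually_elim
      case (elim M)
      obtain B where B: "B \<le> 4 * (a / 2) ^ M" "exp (?s M) \<le> C ^ M * B" using key[OF elim(2)] by auto
      have "exp (mean_potential a - e) ^ M = exp (real M * (mean_potential a - e))"
        by (simp add: exp_of_nat_mult)
      also have "\<dots> \<le> exp (?s M)" using elim by (simp add: field_simps)
      also have "\<dots> \<le> C ^ M * (4 * (a / 2) ^ M)"
        using B \<open>C \<ge> 0\<close> by (meson mult_left_mono order_trans zero_le_power)
      finally show ?case by (simp add: power_mult_distrib power_divide mult_ac)
    qed
  qed (use \<open>C \<ge> 0\<close> a in auto)
  then have "exp (mean_potential a) \<le> C * a / 2 * exp (1 * e)" if "e > 0" for e
    using that by (simp add: exp_diff divide_le_eq)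
  then have "exp (mean_potential a) \<le> C * a / 2 * exp (1 * 0)"
    by (rule le_exp_of_le_exp_plus) simp
  then show ?thesis using a by (simp add: field_simps)
qed

section \<open>Evaluation of the mean potential\<close>

text \<open>No point of the segment is farther than \<open>2 * a \<le> 1\<close> from
  \<open>a\<close>, so the truncated logarithm vanishes identically.\<close>

lemma mean_potential_eq_0:
  assumes "0 < a" "a \<le> 1 / 2"
  shows "mean_potential a = 0"
proof -
  have "endpoint_potential a t = 0" for t
  proof -
    have "a * (- 1) \<le> a * cos t" using assms by (intro mult_left_mono) auto
    then show ?thesis using assms by (simp add: endpoint_potential_def max_absorb1)
  qed
  then have "endpoint_potential a = (\<lambda>_. 0)" by auto
  then show ?thesis by (simp add: mean_potential_def)
qed

text \<open>Evenness reduces the mean to the half period from \<open>0\<close> to \<open>pi\<close>,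
  and the substitution \<open>t = - a * cos s\<close> turns \<open>a - a * cos s\<close> into
  \<open>t + a\<close>. The truncation at 1 cuts off the part \<open>t < 1 - a\<close>.\<close>

lemma mean_potential_eq_integral:
  assumes a: "a > 1 / 2"
  shows "mean_potential a = integral {1 - a..a} (\<lambda>t. ln (t + a) / (pi * sqrt (a\<^sup>2 - t\<^sup>2)))"
proof -
  let ?H = "endpoint_potential a"
  \<comment> \<open>\<open>g\<close> inverts \<open>t = - a * cos s\<close>; the sign makes it
    increasing, with \<open>g a = pi\<close>.\<close>
  define g where "g = (\<lambda>t. arccos (- t / a))"
  have int: "?H integrable_on {x..y}" for x y
    by (intro integrable_continuous_real continuous_intros)
  have "2 * pi * mean_potential a = integral {-pi..-pi + 2 * pi} ?H"
    by (subst integral_periodic_shift) (auto simp: mean_potential_def intro!: continuous_intros)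
  also have "\<dots> = integral {-pi..0} ?H + integral {0..pi} ?H"
    by (subst Henstock_Kurzweil_Integration.integral_combine) (auto intro: int)
  also have "integral {-pi..0} ?H = integral {0..pi} ?H"
    using Henstock_Kurzweil_Integration.integral_reflect_real[of pi 0 ?H] by simp
  finally have half: "pi * mean_potential a = integral {0..pi} ?H" by simp
  have ratio: "(a - 1) / a \<in> {-1..1}" using a by (auto simp: field_simps)
  have "- (1 - a) / a = (a - 1) / a" by simp
  then have g0: "g (1 - a) = arccos ((a - 1) / a)" by (simp only: g_def)
  have ga: "g a = pi" using a by (simp add: g_def)
  have g_range: "0 \<le> g (1 - a)" "g (1 - a) \<le> pi"
    unfolding g0 using ratio by (auto intro: arccos_lbound arccos_ubound)
  have "integral {0..g (1 - a)} ?H = integral {0..g (1 - a)} (\<lambda>_. 0)"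
  proof (rule integral_cong)
    fix s assume s: "s \<in> {0..g (1 - a)}"
    then have "cos (g (1 - a)) \<le> cos s" using g_range by (intro cos_monotone_0_pi_le) auto
    then have "(a - 1) / a \<le> cos s" unfolding g0 using ratio by simp
    then have "a - a * cos s \<le> 1" using a by (simp add: field_simps)
    then show "?H s = 0" by (simp add: endpoint_potential_def max_absorb1)
  qed
  then have "integral {0..pi} ?H = integral {g (1 - a)..g a} ?H"
    using Henstock_Kurzweil_Integration.integral_combine[OF g_range int] ga by simp
  moreover have "((\<lambda>t. (1 / sqrt (a\<^sup>2 - t\<^sup>2)) *\<^sub>R ?H (g t)) has_integral integral {g (1 - a)..g a} ?H) {1 - a..a}"
  \<comment> \<open>The derivative of \<open>g\<close> blows up at \<open>t = a\<close>, so this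
    point is exempted; there the integrand has the value 0 by division by zero.\<close>
  proof (rule has_integral_substitution_strong)
    show "continuous_on {1 - a..a} g" unfolding g_def
      using a by (intro continuous_intros) (auto simp: field_simps)
    show "g ` {1 - a..a} \<subseteq> {0..pi}" unfolding g_def
      using a by (auto simp: field_simps intro!: arccos_lbound arccos_ubound)
    show "(g has_field_derivative 1 / sqrt (a\<^sup>2 - t\<^sup>2)) (at t within {1 - a..a})" if "t \<in> {1 - a..a} - {a}" for t
    proof -
      have t: "- 1 < - t / a" "- t / a < 1" using that a by (auto simp: field_simps)
      have "(g has_field_derivative inverse (- sqrt (1 - (- t / a)\<^sup>2)) * (- 1 / a)) (at t within {1 - a..a})"
        unfolding g_def
        by (rule DERIV_chain2[where f = arccos and g = "\<lambda>t. - t / a", OF DERIV_arccos[OF t]]) (use a in \<open>auto intro!: derivative_eq_intros\<close>)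
      moreover have "sqrt (1 - (- t / a)\<^sup>2) = sqrt (a\<^sup>2 - t\<^sup>2) / a"
      proof -
        have "1 - (- t / a)\<^sup>2 = (a\<^sup>2 - t\<^sup>2) / a\<^sup>2" using a by (simp add: field_simps)
        then show ?thesis using a by (simp add: real_sqrt_divide)
      qed
      ultimately show ?thesis using a by (simp add: field_simps)
    qed
  qed (use a g_range ga in \<open>auto intro!: continuous_intros\<close>)
  ultimately have I: "((\<lambda>t. (1 / sqrt (a\<^sup>2 - t\<^sup>2)) *\<^sub>R ?H (g t)) has_integral pi * mean_potential a) {1 - a..a}"
    by (simp add: half)
  have "((\<lambda>t. (1 / pi) * ((1 / sqrt (a\<^sup>2 - t\<^sup>2)) *\<^sub>R ?H (g t))) has_integral (1 / pi) * (pi * mean_potential a)) {1 - a..a}"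
    by (rule has_integral_mult_right[OF I])
  then have "((\<lambda>t. ln (t + a) / (pi * sqrt (a\<^sup>2 - t\<^sup>2))) has_integral (1 / pi) * (pi * mean_potential a)) {1 - a..a}"
  proof (rule has_integral_eq[rotated])
    fix t assume t: "t \<in> {1 - a..a}"
    then have "cos (g t) = - t / a" unfolding g_def using a by (intro cos_arccos) (auto simp: field_simps)
    then have "?H (g t) = ln (t + a)"
      using t a by (simp add: endpoint_potential_def max_absorb2 add.commute)
    then show "(1 / pi) * ((1 / sqrt (a\<^sup>2 - t\<^sup>2)) *\<^sub>R ?H (g t)) = ln (t + a) / (pi * sqrt (a\<^sup>2 - t\<^sup>2))"
      by simp
  qed
  then show ?thesis by (simp add: integral_unique)
qed

theorem corollary2p3:
  fixes a C :: real
  assumes "a > 0"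
  shows "best_factor_constant (real_segment a) C \<longleftrightarrow>
    C = (if a \<le> 1/2 then 2 / a
         else 2 / a * exp (integral {1 - a..a} (\<lambda>t. ln (t + a) / (pi * sqrt (a\<^sup>2 - t\<^sup>2)))))"
proof -
  have "best_factor_constant (real_segment a) C \<longleftrightarrow> C = 2 / a * exp (mean_potential a)"
    using factor_constant_segment[OF assms] factor_constant_segment_ge[OF assms]
    unfolding best_factor_constant_def by (blast intro: order_antisym)
  then show ?thesis
    using mean_potential_eq_0[of a] mean_potential_eq_integral[of a] assms by simp
qed

end
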